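(* Let $(\Omega,\mathcal F,\mathbb P)$ be a complete probability space with a filtration $(\mathcal F_n)_{n\ge0}$ such that $\mathcal F=\sigma(\bigcup_n\mathcal F_n)$ and every $\mathcal F_n$ is generated by countably many atoms. Let $p(\cdot):\Omega\to(0,\infty)$ be measurable with $1\le p_-\le p_+<\infty$, and assume there is a constant $K\ge1$ such that $\mathbb P(A)^{p_-(A)-p_+(A)}\le K$ for every atom $A$ of every $\mathcal F_n$. Then there is a constant $C$ (independent of $f$) such that for every $f\in L_{p(\cdot)}$, $$\sup_{\lambda>0}\lambda\,\|\chi_{\{M(f)>\lambda\}}\|_{p(\cdot)}\le C\|f\|_{p(\cdot)}.$$
   Context: For measurable $A$, $p_-(A)=\operatorname{ess\,inf}_Ap$, $p_+(A)=\operatorname{ess\,sup}_Ap$; $p_\pm=p_\pm(\Omega)$. $\|f\|_{p(\cdot)}=\inf\{\lambda>0:\int_\Omega(|f|/\lambda)^{p(x)}d\mathbb P\le1\}$, and $L_{p(\cdot)}$ is the space of measurable functions with $\|f\|_{p(\cdot)}<\infty$. $B\in\mathcal F_n$ (of positive measure) is an atom of $\mathcal F_n$ if every $A\subset B$, $A\in\mathcal F_n$ with $\mathbb P(A)<\mathbb P(B)$ has $\mathbb P(A)=0$. The Doob maximal function is $M(f)=\sup_{n\ge0}|f_n|$ with $f_n=\mathbb E(f|\mathcal F_n)$. *)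

theory Defs
  imports "HOL-Probability.Probability"
begin

text \<open>\<open>\<G>\<close> generates the \<open>\<sigma>\<close>-algebra of \<open>N\<close>, where \<open>N\<close> is \<open>M\<close> or a subalgebra of it.
  On a complete probability space equality of \<open>\<sigma>\<close>-algebras is understood up to null sets:
  a complete \<open>\<sigma>\<close>-algebra with an uncountable null set is typically not generated by countably
  many sets in the strict sense (e.g. the Lebesgue \<open>\<sigma>\<close>-algebra of the unit interval with its
  dyadic filtration). Strict generation, \<open>sets N = sigma_sets (space M) \<G>\<close>, is a special case,
  and \<open>N\<close> may, but need not, contain the null sets of \<open>M\<close>.\<close>

definition generates_mod_null :: "'a measure \<Rightarrow> 'a set set \<Rightarrow> 'a measure \<Rightarrow> bool" where
  "generates_mod_null M \<G> N \<longleftrightarrow>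
     \<G> \<subseteq> sets N \<and> sets N \<subseteq> sigma_sets (space M) (\<G> \<union> null_sets M)"

definition atom_of :: "'a measure \<Rightarrow> 'a measure \<Rightarrow> 'a set \<Rightarrow> bool" where
  "atom_of M N B \<longleftrightarrow>
     B \<in> sets N \<and> 0 < measure M B \<and>
     (\<forall>A\<in>sets N. A \<subseteq> B \<longrightarrow> measure M A < measure M B \<longrightarrow> measure M A = 0)"

definition generated_by_countably_many_atoms :: "'a measure \<Rightarrow> 'a measure \<Rightarrow> bool" where
  "generated_by_countably_many_atoms M N \<longleftrightarrow>
     (\<exists>\<A>. countable \<A> \<and> (\<forall>B\<in>\<A>. atom_of M N B) \<and> generates_mod_null M \<A> N)"

definition p_plus :: "'a measure \<Rightarrow> ('a \<Rightarrow> real) \<Rightarrow> 'a set \<Rightarrow> ereal" where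
  "p_plus M p A = esssup (restrict_space M A) (\<lambda>x. ereal (p x))"

text \<open>The essential infimum is not in the library; it is \<open>- esssup (- p)\<close>.\<close>

definition p_minus :: "'a measure \<Rightarrow> ('a \<Rightarrow> real) \<Rightarrow> 'a set \<Rightarrow> ereal" where
  "p_minus M p A = - esssup (restrict_space M A) (\<lambda>x. - ereal (p x))"

text \<open>The value is \<open>\<infinity>\<close> when no \<open>r\<close> is admissible.\<close>

definition lux_norm :: "'a measure \<Rightarrow> ('a \<Rightarrow> real) \<Rightarrow> ('a \<Rightarrow> real) \<Rightarrow> ennreal" where
  "lux_norm M p f =
     (INF r\<in>{r::real. 0 < r \<and> (\<integral>\<^sup>+ x. ennreal ((\<bar>f x\<bar> / r) powr p x) \<partial>M) \<le> 1}. ennreal r)"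

definition var_Lp :: "'a measure \<Rightarrow> ('a \<Rightarrow> real) \<Rightarrow> ('a \<Rightarrow> real) set" where
  "var_Lp M p = {f \<in> borel_measurable M. lux_norm M p f < \<infinity>}"

definition doob_max :: "'a measure \<Rightarrow> (nat \<Rightarrow> 'a measure) \<Rightarrow> ('a \<Rightarrow> real) \<Rightarrow> 'a \<Rightarrow> ennreal" where
  "doob_max M F f x = (SUP n. ennreal \<bar>real_cond_exp M (F n) f x\<bar>)"

end

theory Submission
  imports Defs
begin

text \<open>
  Let \<open>\<integral> (\<bar>f\<bar> / s) powr p \<le> 1\<close> and let \<open>t > 0\<close>. Split the set where the maximal function exceeds \<open>t\<close>
  according to the first \<open>n\<close> with \<open>\<bar>f\<^sub>n\<bar> > t\<close>. Each part lies in \<open>F n\<close>, so up to null sets it is a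
  countable disjoint union of atoms \<open>A\<close> of \<open>F n\<close> (\<open>atom_partition\<close>), and on each of them the average
  of \<open>g = \<bar>f\<bar> / s\<close> is at least \<open>l = t / s\<close>.

  The heart of the matter is the estimate \<open>\<integral>\<^sub>A l powr p \<le> c * \<integral>\<^sub>A (g powr p + 1)\<close> on one atom
  (\<open>modular_estimate_on\<close>), where \<open>c\<close> depends on the upper bound of \<open>p\<close> and on \<open>K\<close> only. It combines
  Jensen's inequality for the constant exponent \<open>p\<^sub>-(A)\<close> with the hypothesis that
  \<open>measure M A powr (p\<^sub>-(A) - p\<^sub>+(A))\<close> is bounded by \<open>K\<close>, which allows the exponent \<open>p\<^sub>-(A)\<close> to be
  replaced by \<open>p x\<close> at the cost of a constant.

  The atoms being disjoint, summation bounds the modular of \<open>l\<close> over the superlevel set by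
  \<open>C = 2 * c\<close> (\<open>modular_doob_max_superlevel\<close>). As \<open>p \<ge> 1\<close>, its indicator has norm at most
  \<open>C / l = C * s / t\<close>, and the infimum over all admissible \<open>s\<close> gives the claim.
\<close>

section \<open>Jensen's inequality for powers\<close>

lemma bernoulli_powr:
  fixes q x :: real
  assumes "1 \<le> q" "0 \<le> x"
  shows "q * x \<le> x powr q + (q - 1)"
proof (cases "x = 0")
  case False
  have "(x powr q) powr (1 / q) * 1 powr (1 - 1 / q) \<le> (1 / q) * x powr q + (1 - 1 / q) * 1"
    using assms False by (intro Youngs_inequality_0) auto
  then have "x \<le> (1 / q) * x powr q + (1 - 1 / q)"
    using assms False by (simp add: powr_powr)
  then have "q * x \<le> q * ((1 / q) * x powr q + (1 - 1 / q))"
    using assms by (intro mult_left_mono) auto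
  also have "\<dots> = x powr q + (q - 1)"
    using assms by (simp add: field_simps)
  finally show ?thesis .
qed (use assms in auto)

text \<open>Jensen's inequality on \<open>A\<close>: a lower bound on the average of \<open>g\<close> passes to powers. Integrating
  the tangent line of \<open>s \<mapsto> s powr q\<close> at \<open>l\<close> avoids any integrability assumption on \<open>g\<close>.\<close>

lemma (in finite_measure) average_powr_ge:
  fixes g :: "'a \<Rightarrow> real"
  assumes [measurable]: "g \<in> borel_measurable M" "A \<in> sets M"
    and g: "\<And>x. 0 \<le> g x" and q: "1 \<le> q" and l: "0 < l"
    and avg: "ennreal l * emeasure M A \<le> (\<integral>\<^sup>+x\<in>A. ennreal (g x) \<partial>M)"
  shows "ennreal (l powr q) * emeasure M A \<le> (\<integral>\<^sup>+x\<in>A. ennreal (g x powr q) \<partial>M)"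
proof -
  let ?I = "\<integral>\<^sup>+x\<in>A. ennreal (g x powr q) \<partial>M"
  define c where "c = q * l powr (q - 1)"
  have c: "0 \<le> c" using q by (simp add: c_def)
  have cl: "c * l = q * l powr q"
    using l by (simp add: c_def powr_diff)
  \<comment> \<open>the tangent line at \<open>l\<close>, with slope \<open>c\<close>\<close>
  have pt: "c * g x \<le> g x powr q + (q - 1) * l powr q" for x
  proof -
    have "q * (g x / l) \<le> (g x / l) powr q + (q - 1)"
      using g q l by (intro bernoulli_powr) auto
    then have "l powr q * (q * (g x / l)) \<le> l powr q * ((g x / l) powr q + (q - 1))"
      by (intro mult_left_mono) auto
    moreover have "l powr q * (q * (g x / l)) = c * g x"
      using l by (simp add: c_def powr_diff)
    moreover have "l powr q * (g x / l) powr q = g x powr q"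
      using g l by (simp add: powr_divide)
    ultimately show ?thesis
      by (simp add: distrib_left mult.commute)
  qed
  have "ennreal (c * l) * emeasure M A = ennreal c * (ennreal l * emeasure M A)"
    using c l by (simp add: ennreal_mult mult.assoc)
  also have "\<dots> \<le> ennreal c * (\<integral>\<^sup>+x\<in>A. ennreal (g x) \<partial>M)"
    by (intro mult_left_mono avg) auto
  also have "\<dots> = (\<integral>\<^sup>+x\<in>A. ennreal (c * g x) \<partial>M)"
    using c g by (subst nn_integral_cmult[symmetric]) (auto simp: ennreal_mult mult.assoc)
  also have "\<dots> \<le> (\<integral>\<^sup>+x. ennreal (g x powr q) * indicator A x +
      ennreal ((q - 1) * l powr q) * indicator A x \<partial>M)"
    using pt q
    by (intro nn_integral_mono) (auto simp: indicator_def ennreal_plus[symmetric] simp del: ennreal_plus)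
  also have "\<dots> = ?I + ennreal ((q - 1) * l powr q) * emeasure M A"
    by (subst nn_integral_add) (auto simp: nn_integral_cmult_indicator)
  finally have *: "ennreal (c * l) * emeasure M A \<le> ?I + ennreal ((q - 1) * l powr q) * emeasure M A" .
  have "c * l = l powr q + (q - 1) * l powr q"
    unfolding cl by (simp add: algebra_simps)
  then have "ennreal (c * l) = ennreal (l powr q) + ennreal ((q - 1) * l powr q)"
    using q by (simp add: ennreal_plus[symmetric] del: ennreal_plus)
  with * have "ennreal ((q - 1) * l powr q) * emeasure M A + ennreal (l powr q) * emeasure M A
      \<le> ennreal ((q - 1) * l powr q) * emeasure M A + ?I"
    by (simp add: distrib_right add.commute)
  moreover have "ennreal ((q - 1) * l powr q) * emeasure M A \<noteq> top"
    by (simp add: ennreal_mult_eq_top_iff)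
  ultimately show ?thesis
    by (simp add: ennreal_add_left_cancel_le)
qed

section \<open>The exponent on a set of positive measure\<close>

lemma AE_restrict_space_set:
  assumes "A \<in> sets M"
  shows "(AE x in restrict_space M A. P x) \<longleftrightarrow> (AE x in M. x \<in> A \<longrightarrow> P x)"
  using assms by (intro AE_restrict_space_iff) (simp add: sets.sets_into_space Int_absorb2)

text \<open>The bounds on the whole space make the essential bounds on \<open>A\<close> finite, so that they may be
  handled as reals.\<close>

lemma exponent_bounds_on:
  fixes p :: "'a \<Rightarrow> real"
  assumes p: "p \<in> borel_measurable M"
    and lower: "1 \<le> p_minus M p (space M)" and upper: "p_plus M p (space M) \<le> ereal P"
    and A: "A \<in> sets M" and pos: "0 < measure M A"
  obtains q r where "p_minus M p A = ereal q" "p_plus M p A = ereal r" "1 \<le> q" "q \<le> r" "r \<le> P"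
    "AE x in M. x \<in> A \<longrightarrow> q \<le> p x \<and> p x \<le> r"
proof -
  have p_plus: "AE x in M. x \<in> B \<longrightarrow> ereal (p x) \<le> p_plus M p B" if "B \<in> sets M" for B
    using esssup_AE[of "\<lambda>x. ereal (p x)" "restrict_space M B"] that
    by (simp add: AE_restrict_space_set p_plus_def)
  have p_minus: "AE x in M. x \<in> B \<longrightarrow> p_minus M p B \<le> ereal (p x)" if "B \<in> sets M" for B
  proof -
    have "AE x in M. x \<in> B \<longrightarrow> - ereal (p x) \<le> - p_minus M p B"
      using esssup_AE[of "\<lambda>x. - ereal (p x)" "restrict_space M B"] that
      by (simp add: AE_restrict_space_set p_minus_def del: uminus_ereal.simps)
    then show ?thesis
      by eventually_elim (simp del: uminus_ereal.simps)
  qed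
  have le: "p_plus M p A \<le> ereal P"
    unfolding p_plus_def
  proof (rule esssup_I)
    show "(\<lambda>x. ereal (p x)) \<in> borel_measurable (restrict_space M A)"
      using p by (intro measurable_restrict_space1) auto
    show "AE x in restrict_space M A. ereal (p x) \<le> ereal P"
      unfolding AE_restrict_space_set[OF A] using p_plus[OF sets.top] AE_space
    proof eventually_elim
      case (elim x)
      then show ?case using upper order_trans by blast
    qed
  qed
  have "esssup (restrict_space M A) (\<lambda>x. - ereal (p x)) \<le> - 1"
  proof (rule esssup_I)
    show "(\<lambda>x. - ereal (p x)) \<in> borel_measurable (restrict_space M A)"
      using p by (intro measurable_restrict_space1) auto
    show "AE x in restrict_space M A. - ereal (p x) \<le> - 1"
      unfolding AE_restrict_space_set[OF A] using p_minus[OF sets.top] AE_space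
    proof eventually_elim
      case (elim x)
      then have "1 \<le> ereal (p x)" using lower order_trans by blast
      then show ?case by (simp add: one_ereal_def)
    qed
  qed
  then have ge: "1 \<le> p_minus M p A"
    unfolding p_minus_def by (metis ereal_minus_le_minus ereal_uminus_uminus)
  have both: "AE x in M. x \<in> A \<longrightarrow> p_minus M p A \<le> ereal (p x) \<and> ereal (p x) \<le> p_plus M p A"
    using p_plus[OF A] p_minus[OF A] by eventually_elim auto
  \<comment> \<open>A point of \<open>A\<close> lying between the two bounds excludes the values \<open>\<infinity>\<close> and \<open>-\<infinity>\<close>.\<close>
  obtain x where x: "p_minus M p A \<le> ereal (p x)" "ereal (p x) \<le> p_plus M p A"
  proof (rule ccontr)
    assume "\<not> thesis"
    then have none: "\<not> (p_minus M p A \<le> ereal (p x) \<and> ereal (p x) \<le> p_plus M p A)" for x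
      using that by blast
    have "AE x in M. x \<notin> A" using both by eventually_elim (use none in blast)
    then have "emeasure M A = 0"
      using A by (simp add: AE_iff_measurable[OF A] sets.sets_into_space subset_eq
        Collect_conj_eq[symmetric] AE_iff_null_sets null_setsD1)
    with pos show False by (simp add: measure_def)
  qed
  obtain q where q: "p_minus M p A = ereal q"
    using ge x by (cases "p_minus M p A") auto
  obtain r where r: "p_plus M p A = ereal r"
    using le x by (cases "p_plus M p A") auto
  have "q \<le> r" using x unfolding q r by (metis ereal_less_eq(3) order_trans)
  then show thesis
    using that[OF q r] ge le both unfolding q r by (simp add: one_ereal_def)
qed

section \<open>The modular estimate on one atom\<close>

text \<open>Let \<open>i = \<integral>\<^sub>A (g powr p + 1)\<close> and let \<open>m\<close> be the measure of \<open>A\<close>, so that \<open>m \<le> i \<le> 2\<close>. Since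
  \<open>g powr q \<le> g powr p + 1\<close>, Jensen's inequality for the constant exponent \<open>q\<close> gives
  \<open>l powr q \<le> i / m\<close>. Raising this to the power \<open>p x / q\<close> costs a factor
  \<open>(i / m) powr ((p x - q) / q) \<le> (2 / m) powr (r - q)\<close>, where \<open>q \<ge> 1\<close> is used, and the right-hand
  side is bounded by the hypothesis on \<open>A\<close>.\<close>

lemma (in prob_space) modular_estimate_on:
  fixes g p :: "'a \<Rightarrow> real"
  assumes [measurable]: "p \<in> borel_measurable M" "g \<in> borel_measurable M" "A \<in> sets M"
    and g: "\<And>x. 0 \<le> g x" and pos: "0 < measure M A"
    and q: "1 \<le> q" and q_le_r: "q \<le> r" and r: "r \<le> P"
    and bounds: "AE x in M. x \<in> A \<longrightarrow> q \<le> p x \<and> p x \<le> r"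
    and K: "measure M A powr (q - r) \<le> K"
    and l: "0 < l"
    and avg: "ennreal l * emeasure M A \<le> (\<integral>\<^sup>+x\<in>A. ennreal (g x) \<partial>M)"
    and modular: "(\<integral>\<^sup>+x. ennreal (g x powr p x) \<partial>M) \<le> 1"
  shows "(\<integral>\<^sup>+x\<in>A. ennreal (l powr p x) \<partial>M)
    \<le> (\<integral>\<^sup>+x\<in>A. ennreal (2 powr P * K) * ennreal (g x powr p x + 1) \<partial>M)"
proof -
  let ?I = "\<integral>\<^sup>+x\<in>A. ennreal (g x powr p x + 1) \<partial>M"
  define m where "m = measure M A"
  have m: "0 < m" "m \<le> 1" "emeasure M A = ennreal m"
    using pos by (auto simp: m_def emeasure_eq_measure)
  have split: "?I = (\<integral>\<^sup>+x\<in>A. ennreal (g x powr p x) \<partial>M) + emeasure M A"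
  proof -
    have "?I = (\<integral>\<^sup>+x. ennreal (g x powr p x) * indicator A x + indicator A x \<partial>M)"
      by (intro nn_integral_cong) (auto simp: indicator_def)
    then show ?thesis
      by (simp add: nn_integral_add)
  qed
  have "(\<integral>\<^sup>+x\<in>A. ennreal (g x powr p x) \<partial>M) \<le> 1"
    by (rule order_trans[OF _ modular]) (auto intro!: nn_integral_mono simp: indicator_def)
  then have "?I \<le> 1 + 1"
    unfolding split by (intro add_mono emeasure_le_1)
  then have I2: "?I \<le> ennreal 2" by simp
  then obtain i where i: "?I = ennreal i" "0 \<le> i"
    by (cases ?I) (auto simp: top_unique)
  have i2: "i \<le> 2" using I2 unfolding i(1) by (subst (asm) ennreal_le_iff) auto
  have "ennreal m \<le> ennreal i" unfolding i(1)[symmetric] m(3)[symmetric] split by simp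
  then have mi: "m \<le> i" using i by simp
  have "ennreal (l powr q) * emeasure M A \<le> (\<integral>\<^sup>+x\<in>A. ennreal (g x powr q) \<partial>M)"
    using g q l avg by (intro average_powr_ge) auto
  also have "\<dots> \<le> ?I"
  proof (rule nn_integral_mono_AE, use bounds in eventually_elim)
    case (elim x)
    have "g x powr q \<le> g x powr p x + 1" if "x \<in> A"
    proof (cases "g x \<le> 1")
      case True
      then have "g x powr q \<le> 1" using g q by (intro powr_le1) auto
      then show ?thesis by (simp add: add_increasing)
    next
      case False
      then have "g x powr q \<le> g x powr p x" using elim that by (intro powr_mono) auto
      then show ?thesis by simp
    qed
    then show ?case by (auto simp: indicator_def intro!: ennreal_leI simp del: ennreal_plus)
  qed
  finally have "l powr q * m \<le> i"
    using i m by (simp add: ennreal_mult[symmetric])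
  then have lq: "l powr q \<le> i / m" using m by (simp add: field_simps)
  have im: "1 \<le> i / m" "i / m \<le> 2 / m"
    using m mi i2 by (auto simp: divide_right_mono)
  have pt: "l powr p x \<le> 2 powr P * K * (i / m)" if "q \<le> p x" "p x \<le> r" for x
  proof -
    have "(p x - q) / q \<le> (p x - q) / 1" using q that by (intro divide_left_mono) auto
    then have "(i / m) powr ((p x - q) / q) \<le> (i / m) powr (r - q)"
      using im that by (intro powr_mono) auto
    also have "\<dots> \<le> (2 / m) powr (r - q)"
      using im q_le_r by (intro powr_mono2) auto
    also have "\<dots> = 2 powr (r - q) * m powr (q - r)"
      using m powr_minus_divide[of m "r - q"] by (simp add: powr_divide)
    also have "\<dots> \<le> 2 powr P * K"
      using q r K by (intro mult_mono powr_mono) (auto simp: m_def)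
    finally have excess: "(i / m) powr ((p x - q) / q) \<le> 2 powr P * K" .
    have "l powr p x = (l powr q) powr (p x / q)"
      using q by (simp add: powr_powr)
    also have "\<dots> \<le> (i / m) powr (p x / q)"
      using q that lq by (intro powr_mono2) auto
    also have "p x / q = 1 + (p x - q) / q"
      using q by (simp add: diff_divide_distrib)
    also have "(i / m) powr (1 + (p x - q) / q) = (i / m) * (i / m) powr ((p x - q) / q)"
      using m i by (simp add: powr_add)
    also have "\<dots> \<le> (i / m) * (2 powr P * K)"
      using excess im by (intro mult_left_mono) auto
    finally show ?thesis by (simp only: mult.commute)
  qed
  have K0: "0 \<le> K" using K powr_ge_zero order_trans by blast
  have "(\<integral>\<^sup>+x\<in>A. ennreal (l powr p x) \<partial>M)
      \<le> (\<integral>\<^sup>+x. ennreal (2 powr P * K * (i / m)) * indicator A x \<partial>M)"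
    by (rule nn_integral_mono_AE, use bounds in eventually_elim)
      (use pt in \<open>auto simp: indicator_def intro!: ennreal_leI\<close>)
  also have "\<dots> = ennreal (2 powr P * K * (i / m)) * ennreal m"
    by (simp add: nn_integral_cmult_indicator m)
  also have "\<dots> = ennreal (2 powr P * K) * ennreal i"
    using m i K0 by (simp add: ennreal_mult[symmetric])
  also have "\<dots> = (\<integral>\<^sup>+x\<in>A. ennreal (2 powr P * K) * ennreal (g x powr p x + 1) \<partial>M)"
    unfolding i(1)[symmetric] by (subst nn_integral_cmult[symmetric]) (auto simp: mult.assoc)
  finally show ?thesis .
qed

section \<open>Decomposition into atoms\<close>

lemma null_or_atom_subset:
  assumes "measure M B = 0 \<or> atom_of M N B" "A \<subseteq> B" "A \<in> sets N"
    and "finite_measure M" "subalgebra M N" "B \<in> sets N"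
  shows "measure M A = 0 \<or> atom_of M N A"
proof -
  interpret finite_measure M by fact
  have BM: "B \<in> sets M" using assms(5,6) by (auto simp: subalgebra_def)
  have le: "measure M A \<le> measure M B"
    using assms(2) BM by (rule finite_measure_mono)
  show ?thesis
  proof (cases "measure M A = measure M B")
    case True
    then show ?thesis
      using assms(1-3) by (auto simp: atom_of_def)
  next
    case False
    then show ?thesis
      using le assms(1-3) measure_nonneg[of M A] by (auto simp: atom_of_def)
  qed
qed

text \<open>Generating atoms need not cover the space (the empty family generates the trivial
  \<open>\<sigma>\<close>-algebra), but up to null sets the uncovered part is contained in, or disjoint from, every
  generated set.\<close>

lemma uncovered_part_indivisible:
  assumes "S \<in> sigma_sets (space M) (\<A> \<union> null_sets M)"
    and sub: "\<A> \<subseteq> sets M"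
    and R: "R \<in> sets M" "R \<inter> \<Union>\<A> = {}"
  shows "S \<inter> R \<in> null_sets M \<or> R - S \<in> null_sets M"
  using assms(1)
proof induction
  case (Basic a)
  then consider "a \<in> \<A>" | "a \<in> null_sets M" by auto
  then show ?case
  proof cases
    case 1
    then have "a \<inter> R = {}" using R by blast
    then show ?thesis by simp
  next
    case 2
    then show ?thesis using R null_set_Int2[OF 2] by simp
  qed
next
  case Empty
  then show ?case by simp
next
  case (Compl a)
  have "(space M - a) \<inter> R = R - a" "R - (space M - a) = a \<inter> R"
    using sets.sets_into_space[OF R(1)] by auto
  with Compl show ?case by auto
next
  case (Union a)
  have "\<And>i. a i \<in> sets M"
  proof -
    have "sigma_sets (space M) (\<A> \<union> null_sets M) \<subseteq> sets M"
      using sub by (intro sets.sigma_sets_subset) auto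
    then show "a i \<in> sets M" for i using Union.hyps by blast
  qed
  then have meas: "(\<Union>i. a i) \<in> sets M" by auto
  show ?case
  proof (cases "\<exists>i. R - a i \<in> null_sets M")
    case True
    then obtain i where "R - a i \<in> null_sets M" by blast
    then have "R - (\<Union>i. a i) \<in> null_sets M"
      by (rule null_sets_subset) (use R meas in auto)
    then show ?thesis ..
  next
    case False
    then have "\<And>i. a i \<inter> R \<in> null_sets M" using Union.IH by blast
    then have "(\<Union>i. a i \<inter> R) \<in> null_sets M" by (rule null_sets_UN)
    moreover have "(\<Union>i. a i) \<inter> R = (\<Union>i. a i \<inter> R)" by blast
    ultimately show ?thesis by (simp only: simp_thms)
  qed
qed

lemma atom_partition:
  assumes fin: "finite_measure M" and sub: "subalgebra M N"
    and gen: "generated_by_countably_many_atoms M N"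
  shows "\<exists>D :: nat \<Rightarrow> 'a set. disjoint_family D \<and> (\<Union>k. D k) = space M \<and>
    (\<forall>k. D k \<in> sets N \<and> (measure M (D k) = 0 \<or> atom_of M N (D k)))"
proof -
  interpret finite_measure M by fact
  have space: "space N = space M" and sets: "sets N \<subseteq> sets M"
    using sub by (auto simp: subalgebra_def)
  obtain \<A> where \<A>: "countable \<A>" "\<And>B. B \<in> \<A> \<Longrightarrow> atom_of M N B"
    "\<A> \<subseteq> sets N" "sets N \<subseteq> sigma_sets (space M) (\<A> \<union> null_sets M)"
    using gen unfolding generated_by_countably_many_atoms_def generates_mod_null_def by blast
  define R where "R = space M - \<Union>\<A>"
  have "\<Union>\<A> \<in> sets N" using \<A> by (intro sets.countable_Union) auto
  then have RN: "R \<in> sets N" unfolding R_def space[symmetric] by auto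
  then have RM: "R \<in> sets M" using sets by auto
  \<comment> \<open>The uncovered part is one more atom, unless it is null.\<close>
  have R: "measure M R = 0 \<or> atom_of M N R"
  proof -
    have "measure M A = 0" if A: "A \<in> sets N" "A \<subseteq> R" "measure M A < measure M R" for A
    proof -
      have AM: "A \<in> sets M" using A sets by auto
      have "A \<inter> R \<in> null_sets M \<or> R - A \<in> null_sets M"
        using A \<A> sets RM by (intro uncovered_part_indivisible[of _ _ \<A>]) (auto simp: R_def)
      moreover have "A \<inter> R = A" using A by auto
      moreover have "measure M (R - A) = measure M R - measure M A"
        using AM RM A by (intro finite_measure_Diff) auto
      ultimately show ?thesis
        using A(3) by (auto simp: null_sets_def measure_def)
    qed
    then show ?thesis
      using RN by (auto simp: atom_of_def zero_less_measure_iff)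
  qed
  \<comment> \<open>The atoms may overlap or repeat, so the sequence is made disjoint; a subset of an atom that
    belongs to \<open>N\<close> is again null or an atom.\<close>
  define B where "B = from_nat_into (insert R \<A>)"
  have range: "range B = insert R \<A>"
    unfolding B_def using \<A>(1) by (intro range_from_nat_into) auto
  have BN: "B k \<in> sets N" and B: "measure M (B k) = 0 \<or> atom_of M N (B k)" for k
  proof -
    have "B k \<in> insert R \<A>" using range by blast
    then show "B k \<in> sets N" "measure M (B k) = 0 \<or> atom_of M N (B k)"
      using R RN \<A> by auto
  qed
  have DN: "disjointed B k \<in> sets N" for k
    using sets.range_disjointed_sets[of B N] BN by blast
  show ?thesis
  proof (intro exI[of _ "disjointed B"] conjI allI)
    show "disjoint_family (disjointed B)" by (rule disjoint_family_disjointed)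
    have "(\<Union>k. disjointed B k) = \<Union>(insert R \<A>)"
      unfolding UN_disjointed_eq range[symmetric] by simp
    also have "\<dots> = space M"
      using \<A>(3) sets.sets_into_space[of _ N] space by (auto simp: R_def)
    finally show "(\<Union>k. disjointed B k) = space M" .
    show "disjointed B k \<in> sets N" for k by (rule DN)
    show "measure M (disjointed B k) = 0 \<or> atom_of M N (disjointed B k)" for k
      using B[of k] disjointed_subset[of B k] DN[of k] fin sub BN[of k]
      by (rule null_or_atom_subset)
  qed
qed

section \<open>The weak-type estimate\<close>

lemma set_nn_integral_mono_UN:
  fixes D :: "nat \<Rightarrow> 'a set"
  assumes [measurable]: "u \<in> borel_measurable M" "v \<in> borel_measurable M" "\<And>k. D k \<in> sets M"
    and disj: "disjoint_family D"
    and le: "\<And>k. (\<integral>\<^sup>+x\<in>D k. u x \<partial>M) \<le> (\<integral>\<^sup>+x\<in>D k. v x \<partial>M)"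
  shows "(\<integral>\<^sup>+x\<in>(\<Union>k. D k). u x \<partial>M) \<le> (\<integral>\<^sup>+x\<in>(\<Union>k. D k). v x \<partial>M)"
proof -
  have eq: "(\<integral>\<^sup>+x\<in>(\<Union>k. D k). w x \<partial>M) = (\<Sum>k. \<integral>\<^sup>+x\<in>D k. w x \<partial>M)"
    if [measurable]: "w \<in> borel_measurable M" for w :: "'a \<Rightarrow> ennreal"
    using suminf_emeasure[of D "density M w"] disj by (simp add: emeasure_density subset_eq)
  show ?thesis
    unfolding eq[OF assms(1)] eq[OF assms(2)] by (intro suminf_le le) auto
qed

lemma (in sigma_finite_subalgebra) set_nn_integral_real_cond_exp_le:
  assumes [measurable]: "f \<in> borel_measurable M" and A: "A \<in> sets F"
  shows "(\<integral>\<^sup>+x\<in>A. ennreal \<bar>real_cond_exp M F f x\<bar> \<partial>M) \<le> (\<integral>\<^sup>+x\<in>A. ennreal \<bar>f x\<bar> \<partial>M)"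
proof -
  have "(\<integral>\<^sup>+x\<in>A. ennreal \<bar>real_cond_exp M F f x\<bar> \<partial>M)
      \<le> (\<integral>\<^sup>+x. indicator A x * nn_cond_exp M F (\<lambda>x. ennreal \<bar>f x\<bar>) x \<partial>M)"
    by (rule nn_integral_mono_AE, use real_cond_exp_abs[OF assms(1)] in eventually_elim)
      (auto simp: indicator_def)
  also have "\<dots> = (\<integral>\<^sup>+x. indicator A x * ennreal \<bar>f x\<bar> \<partial>M)"
    using A by (intro nn_cond_exp_intg) auto
  finally show ?thesis by (simp add: mult.commute)
qed

text \<open>The superlevel set of the maximal function is split by the first index \<open>n\<close> at which the
  martingale exceeds \<open>t\<close> in absolute value, and each part, being in \<open>F n\<close>, by the atoms of \<open>F n\<close>.\<close>

lemma modular_doob_max_superlevel: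
  fixes f p :: "'a \<Rightarrow> real" and F :: "nat \<Rightarrow> 'a measure"
  assumes prob: "prob_space M" and filt: "filtration (space M) F"
    and sub: "\<And>n. subalgebra M (F n)"
    and atoms: "\<And>n. generated_by_countably_many_atoms M (F n)"
    and p[measurable]: "p \<in> borel_measurable M"
    and lower: "1 \<le> p_minus M p (space M)" and upper: "p_plus M p (space M) \<le> ereal P"
    and p_atoms: "\<And>n A. atom_of M (F n) A \<Longrightarrow>
      measure M A powr real_of_ereal (p_minus M p A - p_plus M p A) \<le> K"
    and f[measurable]: "f \<in> borel_measurable M" and s: "0 < s" and t: "0 < t"
    and modular: "(\<integral>\<^sup>+x. ennreal ((\<bar>f x\<bar> / s) powr p x) \<partial>M) \<le> 1"
  shows "{x \<in> space M. ennreal t < doob_max M F f x} \<in> sets M" (is "?E \<in> _")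
    and "(\<integral>\<^sup>+x\<in>{x \<in> space M. ennreal t < doob_max M F f x}. ennreal ((t / s) powr p x) \<partial>M)
      \<le> ennreal (2 * (2 powr P * K))"
proof -
  interpret prob_space M by fact
  have sfs: "sigma_finite_subalgebra M (F n)" for n
    using finite_measure_axioms sub
    by (intro finite_measure_subalgebra_is_sigma_finite)
      (simp add: finite_measure_subalgebra_def finite_measure_subalgebra_axioms_def)
  have space: "space (F n) = space M" and sets: "sets (F n) \<subseteq> sets M" for n
    using sub[of n] by (auto simp: subalgebra_def)
  define X where "X n x = \<bar>real_cond_exp M (F n) f x\<bar>" for n x
  define E where "E n = {x \<in> space M. t < X n x \<and> (\<forall>k<n. X k x \<le> t)}" for n
  define g where "g x = \<bar>f x\<bar> / s" for x
  let ?u = "\<lambda>x. ennreal ((t / s) powr p x)"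
  let ?v = "\<lambda>x. ennreal (2 powr P * K) * ennreal (g x powr p x + 1)"
  have g: "g \<in> borel_measurable M" "\<And>x. 0 \<le> g x"
    using s by (auto simp: g_def[abs_def])
  have u: "?u \<in> borel_measurable M" and v: "?v \<in> borel_measurable M"
    using g(1) by auto
  have X: "X k \<in> borel_measurable (F n)" if "k \<le> n" for k n
  proof -
    have "X k \<in> borel_measurable (F k)" unfolding X_def[abs_def] by measurable
    then show ?thesis
      using filtration.sets_F_mono[OF filt that] space
      by (auto simp: measurable_def)
  qed
  have EF: "E n \<in> sets (F n)" for n
  proof -
    have level: "{x \<in> space M. t < X k x} \<in> sets (F n)" if "k \<le> n" for k
      using X[OF that] unfolding borel_measurable_iff_greater space by blast
    have "E n = {x \<in> space M. t < X n x} - (\<Union>k\<in>{..<n}. {x \<in> space M. t < X k x})"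
      by (auto simp: E_def not_less)
    also have "\<dots> \<in> sets (F n)"
      by (intro sets.Diff sets.finite_UN level) auto
    finally show ?thesis .
  qed
  have EM: "E n \<in> sets M" for n using EF sets by blast
  have E_eq: "?E = (\<Union>n. E n)"
  proof -
    have "ennreal t < doob_max M F f x \<longleftrightarrow> (\<exists>n. t < X n x)" for x
      using t by (simp add: doob_max_def less_SUP_iff X_def ennreal_less_iff)
    moreover have "(\<exists>n. t < X n x) \<longleftrightarrow> (\<exists>n. t < X n x \<and> (\<forall>k<n. X k x \<le> t))" for x
      using exists_least_iff[of "\<lambda>n. t < X n x"] by (auto simp: not_less)
    ultimately show ?thesis by (auto simp: E_def)
  qed
  show "?E \<in> sets M" unfolding E_eq using EM by blast
  have disjE: "disjoint_family E"
  proof -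
    have less: "E m \<inter> E n = {}" if "m < n" for m n
      using that by (auto simp: E_def not_less[symmetric])
    have "E m \<inter> E n = {}" if "m \<noteq> n" for m n
      using less[of m n] less[of n m] that by (cases m n rule: linorder_cases) auto
    then show ?thesis
      by (simp add: disjoint_family_on_def)
  qed
  have piece: "(\<integral>\<^sup>+x\<in>A. ?u x \<partial>M) \<le> (\<integral>\<^sup>+x\<in>A. ?v x \<partial>M)"
    if A: "atom_of M (F n) A" "A \<subseteq> E n" for n A
  proof -
    have AF: "A \<in> sets (F n)" and pos: "0 < measure M A" using A by (auto simp: atom_of_def)
    then have AM[measurable]: "A \<in> sets M" using sets by blast
    obtain q r where qr: "p_minus M p A = ereal q" "p_plus M p A = ereal r" "1 \<le> q" "q \<le> r" "r \<le> P"
      "AE x in M. x \<in> A \<longrightarrow> q \<le> p x \<and> p x \<le> r"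
      using exponent_bounds_on[OF p lower upper AM pos] .
    have K: "measure M A powr (q - r) \<le> K"
      using p_atoms[OF A(1)] by (simp add: qr)
    have "ennreal t * emeasure M A = (\<integral>\<^sup>+x\<in>A. ennreal t \<partial>M)"
      by (simp add: nn_integral_cmult_indicator)
    also have "\<dots> \<le> (\<integral>\<^sup>+x\<in>A. ennreal (X n x) \<partial>M)"
      using A(2) by (intro nn_integral_mono) (auto simp: indicator_def E_def intro!: ennreal_leI)
    also have "\<dots> \<le> (\<integral>\<^sup>+x\<in>A. ennreal \<bar>f x\<bar> \<partial>M)"
      unfolding X_def
      by (rule sigma_finite_subalgebra.set_nn_integral_real_cond_exp_le[OF sfs f AF])
    finally have "ennreal (1 / s) * (ennreal t * emeasure M A)
        \<le> ennreal (1 / s) * (\<integral>\<^sup>+x\<in>A. ennreal \<bar>f x\<bar> \<partial>M)"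
      by (intro mult_left_mono) auto
    also have "\<dots> = (\<integral>\<^sup>+x\<in>A. ennreal (g x) \<partial>M)"
      using s by (subst nn_integral_cmult[symmetric])
        (auto simp: g_def ennreal_mult[symmetric] mult.assoc[symmetric])
    also have "ennreal (1 / s) * (ennreal t * emeasure M A) = ennreal (t / s) * emeasure M A"
      using s t by (simp add: ennreal_mult[symmetric] mult.assoc[symmetric])
    finally have avg: "ennreal (t / s) * emeasure M A \<le> (\<integral>\<^sup>+x\<in>A. ennreal (g x) \<partial>M)" .
    show ?thesis
      using p g(1) AM g(2) pos qr(3-6) K _ avg
      by (rule modular_estimate_on) (use s t modular in \<open>auto simp: g_def\<close>)
  qed
  have level: "(\<integral>\<^sup>+x\<in>E n. ?u x \<partial>M) \<le> (\<integral>\<^sup>+x\<in>E n. ?v x \<partial>M)" for n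
  proof -
    obtain D :: "nat \<Rightarrow> 'a set" where "disjoint_family D \<and> (\<Union>k. D k) = space M \<and>
        (\<forall>k. D k \<in> sets (F n) \<and> (measure M (D k) = 0 \<or> atom_of M (F n) (D k)))"
      using atom_partition[OF finite_measure_axioms sub[of n] atoms[of n]] ..
    then have D: "disjoint_family D" "(\<Union>k. D k) = space M"
      "\<And>k. D k \<in> sets (F n)" "\<And>k. measure M (D k) = 0 \<or> atom_of M (F n) (D k)"
      by simp_all
    let ?D = "\<lambda>k. D k \<inter> E n"
    have DF: "?D k \<in> sets (F n)" for k using D(3) EF by blast
    have DM: "?D k \<in> sets M" for k using DF sets by blast
    have le: "(\<integral>\<^sup>+x\<in>?D k. ?u x \<partial>M) \<le> (\<integral>\<^sup>+x\<in>?D k. ?v x \<partial>M)" for k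
    proof -
      have "measure M (?D k) = 0 \<or> atom_of M (F n) (?D k)"
        using D(4)[of k] Int_lower1 DF[of k] finite_measure_axioms sub[of n] D(3)[of k]
        by (rule null_or_atom_subset)
      then show ?thesis
      proof
        assume "measure M (?D k) = 0"
        then have "?D k \<in> null_sets M" using DM by (simp add: null_sets_def emeasure_eq_measure)
        then have "(\<integral>\<^sup>+x\<in>?D k. ?u x \<partial>M) = 0" by (rule nn_integral_null_set)
        then show ?thesis by simp
      next
        assume "atom_of M (F n) (?D k)"
        then show ?thesis by (rule piece) simp
      qed
    qed
    have disj: "disjoint_family ?D"
      using D(1) by (auto simp: disjoint_family_on_def)
    have E_n: "(\<Union>k. ?D k) = E n"
      using D(2) sets.sets_into_space[OF EM[of n]] by blast
    show ?thesis
      using set_nn_integral_mono_UN[OF u v DM disj le] unfolding E_n .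
  qed
  have "(\<integral>\<^sup>+x\<in>?E. ?u x \<partial>M) \<le> (\<integral>\<^sup>+x\<in>?E. ?v x \<partial>M)"
    unfolding E_eq by (rule set_nn_integral_mono_UN[OF u v EM disjE level])
  also have "\<dots> \<le> (\<integral>\<^sup>+x. ?v x \<partial>M)"
    by (intro nn_integral_mono) (auto simp: indicator_def)
  also have "\<dots> = ennreal (2 powr P * K) * (\<integral>\<^sup>+x. ennreal (g x powr p x) + 1 \<partial>M)"
    using g(1) by (subst nn_integral_cmult) auto
  also have "\<dots> = ennreal (2 powr P * K) * ((\<integral>\<^sup>+x. ennreal (g x powr p x) \<partial>M) + 1)"
    using g(1) by (subst nn_integral_add) (auto simp: emeasure_space_1)
  also have "\<dots> \<le> ennreal (2 powr P * K) * (1 + 1)"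
    using modular by (intro mult_left_mono add_mono) (auto simp: g_def)
  also have "\<dots> = ennreal (2 * (2 powr P * K))"
  proof -
    have "ennreal (2 powr P * K * 2) = ennreal (2 powr P * K) * ennreal 2"
      by (rule ennreal_mult'') simp
    then show ?thesis by (simp only: mult.commute[of _ 2]) simp
  qed
  finally show "(\<integral>\<^sup>+x\<in>?E. ?u x \<partial>M) \<le> ennreal (2 * (2 powr P * K))" .
qed

text \<open>Since \<open>p \<ge> 1\<close>, division by \<open>C \<ge> 1\<close> reduces the modular at least by the factor \<open>C\<close>; so a function
  with modular at most \<open>C\<close>, here \<open>a\<close> times the indicator of \<open>E\<close>, has norm at most \<open>C\<close>.\<close>

lemma lux_norm_indicator_le:
  fixes p :: "'a \<Rightarrow> real"
  assumes [measurable]: "p \<in> borel_measurable M" "E \<in> sets M"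
    and p: "AE x in M. 1 \<le> p x" and C: "1 \<le> C" and a: "0 < a"
    and modular: "(\<integral>\<^sup>+x\<in>E. ennreal (a powr p x) \<partial>M) \<le> ennreal C"
  shows "lux_norm M p (indicator E) \<le> ennreal (C / a)"
proof -
  have "(\<integral>\<^sup>+x. ennreal ((\<bar>indicator E x\<bar> / (C / a)) powr p x) \<partial>M)
      \<le> (\<integral>\<^sup>+x. ennreal (1 / C) * (ennreal (a powr p x) * indicator E x) \<partial>M)"
  proof (rule nn_integral_mono_AE, use p in eventually_elim)
    case (elim x)
    have "(a / C) powr p x \<le> 1 / C * a powr p x"
    proof -
      have "C powr 1 \<le> C powr p x" using C elim by (intro powr_mono) auto
      then have "a powr p x / C powr p x \<le> a powr p x / C"
        using C by (intro divide_left_mono) auto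
      then show ?thesis using a C by (simp add: powr_divide)
    qed
    then show ?case
      using C by (auto simp: indicator_def ennreal_mult[symmetric] intro!: ennreal_leI)
  qed
  also have "\<dots> = ennreal (1 / C) * (\<integral>\<^sup>+x\<in>E. ennreal (a powr p x) \<partial>M)"
    by (rule nn_integral_cmult) auto
  also have "\<dots> \<le> ennreal (1 / C) * ennreal C"
    using modular by (intro mult_left_mono) auto
  also have "\<dots> = 1"
    using C by (simp add: ennreal_mult[symmetric])
  finally show ?thesis
    unfolding lux_norm_def using C a by (intro INF_lower) auto
qed

theorem theorem2p26:
  fixes M :: "'a measure" and F :: "nat \<Rightarrow> 'a measure"
    and p :: "'a \<Rightarrow> real" and K :: real
  assumes prob: "prob_space M"
    and complete: "complete_measure M"
    and filt: "filtration (space M) F"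
    and sub: "\<And>n. subalgebra M (F n)"
    and gen: "generates_mod_null M (\<Union>n. sets (F n)) M"
    and atoms: "\<And>n. generated_by_countably_many_atoms M (F n)"
    and p_meas: "p \<in> borel_measurable M"
    and p_pos: "\<And>x. x \<in> space M \<Longrightarrow> 0 < p x"
    and p_bounds: "1 \<le> p_minus M p (space M)"
      "p_minus M p (space M) \<le> p_plus M p (space M)"
      "p_plus M p (space M) < \<infinity>"
    and K: "1 \<le> K"
    and p_atoms: "\<And>n A. atom_of M (F n) A \<Longrightarrow>
      measure M A powr real_of_ereal (p_minus M p A - p_plus M p A) \<le> K"
  shows "\<exists>C::real. 0 \<le> C \<and> (\<forall>f\<in>var_Lp M p.
    (SUP t\<in>{0::real<..}. ennreal t *
       lux_norm M p (indicator {x \<in> space M. ennreal t < doob_max M F f x}))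
    \<le> ennreal C * lux_norm M p f)"
proof -
  define P where "P = real_of_ereal (p_plus M p (space M))"
  have upper: "p_plus M p (space M) \<le> ereal P"
    using p_bounds unfolding P_def by (cases "p_plus M p (space M)") auto
  interpret prob_space M by fact
  have pos: "0 < measure M (space M)" by (simp add: prob_space)
  obtain q r where "p_minus M p (space M) = ereal q" "p_plus M p (space M) = ereal r"
    and qr: "1 \<le> q" "q \<le> r" "r \<le> P" "AE x in M. x \<in> space M \<longrightarrow> q \<le> p x \<and> p x \<le> r"
    using exponent_bounds_on[OF p_meas p_bounds(1) upper sets.top pos] .
  have p1: "AE x in M. 1 \<le> p x"
    using qr(4) AE_space by eventually_elim (use qr(1) in auto)
  have P0: "0 \<le> P" using qr(1-3) by simp
  define C where "C = 2 * (2 powr P * K)"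
  have "1 * 1 \<le> 2 powr P * K"
    using P0 K by (intro mult_mono ge_one_powr_ge_zero) auto
  then have C: "1 \<le> C" unfolding C_def by simp
  show ?thesis
  proof (intro exI[of _ C] conjI ballI)
    show "0 \<le> C" using C by simp
    fix f assume "f \<in> var_Lp M p"
    then have f: "f \<in> borel_measurable M" by (simp add: var_Lp_def)
    let ?E = "\<lambda>t. {x \<in> space M. ennreal t < doob_max M F f x}"
    let ?L = "SUP t\<in>{0::real<..}. ennreal t * lux_norm M p (indicator (?E t))"
    have main: "?L \<le> ennreal C * ennreal s"
      if s: "0 < s" "(\<integral>\<^sup>+ x. ennreal ((\<bar>f x\<bar> / s) powr p x) \<partial>M) \<le> 1" for s
    proof (rule SUP_least)
      fix t :: real assume "t \<in> {0<..}"
      then have t: "0 < t" by simp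
      note E = modular_doob_max_superlevel[OF prob filt sub atoms p_meas p_bounds(1) upper
          p_atoms f s(1) t s(2), folded C_def]
      have "lux_norm M p (indicator (?E t)) \<le> ennreal (C / (t / s))"
        using s t by (intro lux_norm_indicator_le[OF p_meas E(1) p1 C _ E(2)]) auto
      then have "ennreal t * lux_norm M p (indicator (?E t)) \<le> ennreal t * ennreal (C / (t / s))"
        by (intro mult_left_mono) auto
      also have "\<dots> = ennreal C * ennreal s"
        using s t C by (simp add: ennreal_mult[symmetric])
      finally show "ennreal t * lux_norm M p (indicator (?E t)) \<le> ennreal C * ennreal s" .
    qed
    have "?L / ennreal C \<le> lux_norm M p f"
      unfolding lux_norm_def[of M p f]
    proof (rule INF_greatest)
      fix s assume "s \<in> {r. 0 < r \<and> (\<integral>\<^sup>+ x. ennreal ((\<bar>f x\<bar> / r) powr p x) \<partial>M) \<le> 1}"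
      then have "?L \<le> ennreal C * ennreal s" using main by simp
      then show "?L / ennreal C \<le> ennreal s"
        using C by (intro divide_le_posI_ennreal) auto
    qed
    then have "ennreal C * (?L / ennreal C) \<le> ennreal C * lux_norm M p f"
      by (intro mult_left_mono) auto
    moreover have "ennreal C * (?L / ennreal C) = ?L"
      using C by (simp add: ennreal_times_divide mult.commute[of "ennreal C"] mult_divide_eq_ennreal)
    ultimately show "?L \<le> ennreal C * lux_norm M p f" by simp
  qed
qed

end
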